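(* For any integer $L\ge 2$ there exists a four-coloring $f$ of the triangulation $T(3L,3L)$ of the torus with $\deg(f)\equiv 6\pmod{12}$. Hence $\kappa(T(3L,3L),4)>1$. In other words, the zero-temperature Wang--Swendsen--Kotecký (WSK) dynamics for four-colorings on $T(3L,3L)$ is non-ergodic.
   Context: The triangulation $T(r,s)$ of the torus has vertex set $\mathbb{Z}/r\mathbb{Z}\times\mathbb{Z}/s\mathbb{Z}$; edges join $(x,y)$ to $(x+1,y)$, $(x,y+1)$ and $(x+1,y+1)$; triangles are $\{(x,y),(x+1,y),(x+1,y+1)\}$ and $\{(x,y),(x,y+1),(x+1,y+1)\}$. A four-coloring is a proper vertex coloring with colors $\{1,2,3,4\}$. Its degree: regard $f$ as a non-degenerate simplicial map to the boundary $\partial\Delta^3$ of the tetrahedron with vertices $1,2,3,4$; fix orientations of the torus and of $\partial\Delta^3$. For a triangle $\tau$ of $\partial\Delta^3$ let $p$ (resp. $n$) be the number of triangles of $T$ mapped onto $\tau$ with orientation preserved (resp. reversed). Then $\deg(f)=p-n$, independent of $\tau$ and, up to sign, of the orientations. A Kempe change (K-change) interchanges two colors $a,b$ on one connected component of the subgraph induced by the vertices colored $a$ or $b$. Two $q$-colorings are Kempe equivalent if one can be obtained from the other by a finite sequence of K-changes. $\kappa(G,q)$ is the number of Kempe equivalence classes of proper $q$-colorings of $G$ (colorings differing by a global permutation of colors are identified). Zero-temperature WSK dynamics with $q$ colors on a graph $G$: the Markov chain on proper $q$-colorings which at each step chooses uniformly at random two distinct colors $a,b$ and then, independently for each connected component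 of the subgraph induced by the vertices colored $a$ or $b$, with probability $1/2$ interchanges $a$ and $b$ on it, otherwise leaves it unchanged. Ergodic means irreducible (every state can eventually be reached from every other state). *)

theory Defs
  imports "HOL-Probability.Probability" "HOL-Combinatorics.Permutations"
    "HOL-Number_Theory.Cong"
begin

text \<open>Graph colorings. Colorings are taken extensional (\<open>undefined\<close> off the vertex set),
  so that equality of colorings is equality on the vertices.\<close>

record 'a graph =
  verts :: "'a set"
  edges :: "'a set set"

definition colorings :: "'a graph \<Rightarrow> nat \<Rightarrow> ('a \<Rightarrow> nat) set" where
  "colorings G q =
     {f \<in> verts G \<rightarrow>\<^sub>E {1..q}. \<forall>u v. {u, v} \<in> edges G \<longrightarrow> f u \<noteq> f v}"

definition induced_adj :: "'a graph \<Rightarrow> 'a set \<Rightarrow> ('a \<times> 'a) set" where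
  "induced_adj G W = {(u, v). u \<in> W \<and> v \<in> W \<and> {u, v} \<in> edges G}"

definition graph_components :: "'a graph \<Rightarrow> 'a set \<Rightarrow> 'a set set" where
  "graph_components G W = W // (induced_adj G W)\<^sup>*"

definition kempe_components :: "'a graph \<Rightarrow> ('a \<Rightarrow> nat) \<Rightarrow> nat \<Rightarrow> nat \<Rightarrow> 'a set set" where
  "kempe_components G f a b = graph_components G {v \<in> verts G. f v = a \<or> f v = b}"

definition swap_on :: "'a set \<Rightarrow> nat \<Rightarrow> nat \<Rightarrow> ('a \<Rightarrow> nat) \<Rightarrow> 'a \<Rightarrow> nat" where
  "swap_on C a b f = (\<lambda>v. if v \<in> C then Transposition.transpose a b (f v) else f v)"

definition kempe_step :: "'a graph \<Rightarrow> nat \<Rightarrow> (('a \<Rightarrow> nat) \<times> ('a \<Rightarrow> nat)) set" where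
  "kempe_step G q = {(f, g). f \<in> colorings G q \<and>
     (\<exists>a\<in>{1..q}. \<exists>b\<in>{1..q}. a \<noteq> b \<and>
       (\<exists>C\<in>kempe_components G f a b. g = swap_on C a b f))}"

definition color_perm :: "'a graph \<Rightarrow> nat \<Rightarrow> (('a \<Rightarrow> nat) \<times> ('a \<Rightarrow> nat)) set" where
  "color_perm G q = {(f, g). f \<in> colorings G q \<and>
     (\<exists>\<pi>. \<pi> permutes {1..q} \<and> g = restrict (\<pi> \<circ> f) (verts G))}"

text \<open>Kempe equivalence classes, where colorings that differ by a global permutation of the
  colors are identified.\<close>

definition kempe_classes :: "'a graph \<Rightarrow> nat \<Rightarrow> ('a \<Rightarrow> nat) set set" where
  "kempe_classes G q = colorings G q // (kempe_step G q \<union> color_perm G q)\<^sup>*"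

definition kappa :: "'a graph \<Rightarrow> nat \<Rightarrow> nat" where
  "kappa G q = card (kempe_classes G q)"


text \<open>The WSK transition kernel. Drawing an ordered pair of distinct colors induces the uniform
  law on unordered pairs, since interchanging \<open>a\<close> and \<open>b\<close> is symmetric in \<open>a\<close> and \<open>b\<close>.
  The random function \<open>s\<close> records, for each component, the outcome of its own fair coin.\<close>

definition wsk_kernel :: "'a graph \<Rightarrow> nat \<Rightarrow> ('a \<Rightarrow> nat) \<Rightarrow> ('a \<Rightarrow> nat) pmf" where
  "wsk_kernel G q f =
     bind_pmf (pmf_of_set {(a, b). a \<in> {1..q} \<and> b \<in> {1..q} \<and> a \<noteq> b}) (\<lambda>(a, b).
     bind_pmf (Pi_pmf (kempe_components G f a b) False (\<lambda>_. bernoulli_pmf (1 / 2))) (\<lambda>s.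
     return_pmf (swap_on (\<Union>{C \<in> kempe_components G f a b. s C}) a b f)))"

definition n_step :: "('s \<Rightarrow> 's pmf) \<Rightarrow> nat \<Rightarrow> 's \<Rightarrow> 's pmf" where
  "n_step K n x = ((\<lambda>p. bind_pmf p K) ^^ n) (return_pmf x)"

definition irreducible_chain :: "'s set \<Rightarrow> ('s \<Rightarrow> 's pmf) \<Rightarrow> bool" where
  "irreducible_chain S K \<longleftrightarrow> (\<forall>x\<in>S. \<forall>y\<in>S. \<exists>n. pmf (n_step K n x) y > 0)"

definition wsk_ergodic :: "'a graph \<Rightarrow> nat \<Rightarrow> bool" where
  "wsk_ergodic G q \<longleftrightarrow> irreducible_chain (colorings G q) (wsk_kernel G q)"


text \<open>The triangulation \<open>T(r,s)\<close>; residues modulo \<open>r\<close> and \<open>s\<close> are represented by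
  \<open>0, \<dots>, r - 1\<close> and \<open>0, \<dots>, s - 1\<close>.\<close>

type_synonym vertex = "int \<times> int"

definition torus_verts :: "int \<Rightarrow> int \<Rightarrow> vertex set" where
  "torus_verts r s = {0..<r} \<times> {0..<s}"

fun shift :: "int \<Rightarrow> int \<Rightarrow> vertex \<Rightarrow> vertex \<Rightarrow> vertex" where
  "shift r s (i, j) (x, y) = ((x + i) mod r, (y + j) mod s)"

definition torus_graph :: "int \<Rightarrow> int \<Rightarrow> vertex graph" where
  "torus_graph r s = \<lparr> verts = torus_verts r s,
     edges = {{v, shift r s d v} | v d. v \<in> torus_verts r s \<and> d \<in> {(1, 0), (0, 1), (1, 1)}} \<rparr>"

text \<open>The triangles of \<open>T(r,s)\<close>, each with its vertices listed in counterclockwise order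
  (with respect to the standard orientation of the plane, passed on to the torus).\<close>

definition torus_triangles :: "int \<Rightarrow> int \<Rightarrow> (vertex \<times> vertex \<times> vertex) set" where
  "torus_triangles r s =
     {(v, shift r s (1, 0) v, shift r s (1, 1) v) | v. v \<in> torus_verts r s} \<union>
     {(v, shift r s (1, 1) v, shift r s (0, 1) v) | v. v \<in> torus_verts r s}"

text \<open>The faces of the tetrahedron \<open>[1,2,3,4]\<close>, oriented as in its simplicial boundary
  \<open>[2,3,4] - [1,3,4] + [1,2,4] - [1,2,3]\<close>. An oriented triangle is a triple of vertices
  up to cyclic rotation; transposing two vertices reverses the orientation.\<close>

definition tetra_faces :: "(nat \<times> nat \<times> nat) set" where
  "tetra_faces = {(2, 3, 4), (1, 4, 3), (1, 2, 4), (1, 3, 2)}"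

fun rotations :: "'a \<times> 'a \<times> 'a \<Rightarrow> ('a \<times> 'a \<times> 'a) set" where
  "rotations (a, b, c) = {(a, b, c), (b, c, a), (c, a, b)}"

fun opposite :: "'a \<times> 'a \<times> 'a \<Rightarrow> 'a \<times> 'a \<times> 'a" where
  "opposite (a, b, c) = (a, c, b)"

fun map_triple :: "('a \<Rightarrow> 'b) \<Rightarrow> 'a \<times> 'a \<times> 'a \<Rightarrow> 'b \<times> 'b \<times> 'b" where
  "map_triple f (u, v, w) = (f u, f v, f w)"

definition degree_at :: "int \<Rightarrow> int \<Rightarrow> (vertex \<Rightarrow> nat) \<Rightarrow> nat \<times> nat \<times> nat \<Rightarrow> int" where
  "degree_at r s f \<tau> =
     int (card {t \<in> torus_triangles r s. map_triple f t \<in> rotations \<tau>}) -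
     int (card {t \<in> torus_triangles r s. map_triple f t \<in> rotations (opposite \<tau>)})"

definition coloring_degree :: "int \<Rightarrow> int \<Rightarrow> (vertex \<Rightarrow> nat) \<Rightarrow> int" where
  "coloring_degree r s f = degree_at r s f (2, 3, 4)"

text \<open>The remainder shows that \<^const>\<open>coloring_degree\<close>, defined through the face \<open>[2,3,4]\<close>, may be computed
  at any face of the tetrahedron: see the last lemma.\<close>

lemma finite_torus_verts: "finite (torus_verts r s)"
  by (simp add: torus_verts_def)

lemma shift_bij: "bij_betw (shift r s d) (torus_verts r s) (torus_verts r s)"
proof (rule bij_betw_byWitness[where f' = "shift r s (- fst d, - snd d)"])
  show "\<forall>a\<in>torus_verts r s. shift r s (- fst d, - snd d) (shift r s d a) = a"
    by (cases d) (auto simp: torus_verts_def mod_simps)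
  show "\<forall>a\<in>torus_verts r s. shift r s d (shift r s (- fst d, - snd d) a) = a"
    by (cases d) (auto simp: torus_verts_def mod_simps)
qed (cases d, auto simp: torus_verts_def)+

lemma shift_shift: "shift r s d (shift r s e v) = shift r s (fst d + fst e, snd d + snd e) v"
  by (cases d; cases e; cases v) (simp add: mod_simps algebra_simps)

lemma sum_shift: "(\<Sum>v\<in>torus_verts r s. g (shift r s d v)) = (\<Sum>v\<in>torus_verts r s. g v)"
  by (rule sum.reindex_bij_betw[OF shift_bij])

lemma sum_shift': "(\<Sum>v\<in>torus_verts r s. g (shift r s d v) (shift r s (fst e + fst d, snd e + snd d) v)) =
    (\<Sum>v\<in>torus_verts r s. g v (shift r s e v))"
  using sum_shift[of "\<lambda>v. g v (shift r s e v)" r s d] by (simp add: shift_shift add.commute)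

definition face_sign :: "nat \<times> nat \<times> nat \<Rightarrow> nat \<times> nat \<times> nat \<Rightarrow> int" where
  "face_sign \<tau> t = (if t \<in> rotations \<tau> then 1 else 0) - (if t \<in> rotations (opposite \<tau>) then 1 else 0)"

definition edge_sign :: "nat \<Rightarrow> nat \<Rightarrow> nat \<Rightarrow> nat \<Rightarrow> int" where
  "edge_sign a b c d = (if c = a \<and> d = b then 1 else 0) - (if c = b \<and> d = a then 1 else 0)"

lemma finite_torus_triangles: "finite (torus_triangles r s)"
  unfolding torus_triangles_def Setcompr_eq_image using finite_torus_verts by blast

lemma degree_at_sum: "degree_at r s f \<tau> = (\<Sum>t\<in>torus_triangles r s. face_sign \<tau> (map_triple f t))"
  unfolding degree_at_def face_sign_def sum_subtractf
  by (simp add: sum.inter_filter[OF finite_torus_triangles, symmetric])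

lemma sum_torus_triangles:
  fixes h :: "vertex \<times> vertex \<times> vertex \<Rightarrow> int"
  assumes "2 \<le> r" "2 \<le> s"
  shows "(\<Sum>t\<in>torus_triangles r s. h t) =
    (\<Sum>v\<in>torus_verts r s. h (v, shift r s (1, 0) v, shift r s (1, 1) v)
       + h (v, shift r s (1, 1) v, shift r s (0, 1) v))"
proof -
  let ?V = "torus_verts r s"
  let ?A = "(\<lambda>v. (v, shift r s (1, 0) v, shift r s (1, 1) v)) ` ?V"
  let ?B = "(\<lambda>v. (v, shift r s (1, 1) v, shift r s (0, 1) v)) ` ?V"
  have *: "shift r s (1, 0) v \<noteq> shift r s (1, 1) v" if "v \<in> ?V" for v
  proof -
    obtain x y where v: "v = (x, y)" by force
    have "(y + 1) mod s \<noteq> y mod s"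
    proof
      assume "(y + 1) mod s = y mod s"
      then have "s dvd 1" by (metis add_diff_cancel_left' mod_eq_dvd_iff)
      with assms show False by (simp add: zdvd_not_zless)
    qed
    then show ?thesis by (simp add: v)
  qed
  have eq: "torus_triangles r s = ?A \<union> ?B"
    unfolding torus_triangles_def by auto
  have disj: "?A \<inter> ?B = {}"
    using * by fastforce
  have "(\<Sum>t\<in>torus_triangles r s. h t) = sum h ?A + sum h ?B"
    unfolding eq by (rule sum.union_disjoint) (use disj finite_torus_verts in auto)
  also have "sum h ?A = (\<Sum>v\<in>?V. h (v, shift r s (1, 0) v, shift r s (1, 1) v))"
    by (subst sum.reindex) (auto simp: inj_on_def)
  also have "sum h ?B = (\<Sum>v\<in>?V. h (v, shift r s (1, 1) v, shift r s (0, 1) v))"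
    by (subst sum.reindex) (auto simp: inj_on_def)
  finally show ?thesis by (simp add: sum.distrib)
qed

fun boundary_sign :: "nat \<Rightarrow> nat \<Rightarrow> nat \<times> nat \<times> nat \<Rightarrow> int" where
  "boundary_sign a b (c, d, e) = edge_sign a b c d + edge_sign a b d e + edge_sign a b e c"

lemma sum_boundary_sign:
  assumes "2 \<le> r" "2 \<le> s"
  shows "(\<Sum>t\<in>torus_triangles r s. boundary_sign a b (map_triple f t)) = 0"
proof -
  let ?V = "torus_verts r s"
  define g where "g u v = edge_sign a b (f u) (f v)" for u v
  have anti: "g u v = - g v u" for u v
    unfolding g_def edge_sign_def by (simp add: conj_commute)
  have "(\<Sum>t\<in>torus_triangles r s. boundary_sign a b (map_triple f t)) =
    (\<Sum>v\<in>?V. g v (shift r s (1, 0) v) + g (shift r s (1, 0) v) (shift r s (1, 1) v)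
       - g (shift r s (0, 1) v) (shift r s (1, 1) v) - g v (shift r s (0, 1) v))"
    unfolding sum_torus_triangles[OF assms]
  proof (rule sum.cong[OF refl])
    fix v assume "v \<in> ?V"
    let ?a = "shift r s (1, 0) v" and ?b = "shift r s (0, 1) v" and ?c = "shift r s (1, 1) v"
    show "boundary_sign a b (map_triple f (v, ?a, ?c)) + boundary_sign a b (map_triple f (v, ?c, ?b)) =
        g v ?a + g ?a ?c - g ?b ?c - g v ?b"
      using anti[of ?c v] anti[of ?c ?b] anti[of ?b v]
      unfolding map_triple.simps boundary_sign.simps g_def by linarith
  qed
  also have "\<dots> = (\<Sum>v\<in>?V. g v (shift r s (1, 0) v)) + (\<Sum>v\<in>?V. g (shift r s (1, 0) v) (shift r s (1, 1) v))
       - (\<Sum>v\<in>?V. g (shift r s (0, 1) v) (shift r s (1, 1) v)) - (\<Sum>v\<in>?V. g v (shift r s (0, 1) v))"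
    by (simp add: sum.distrib sum_subtractf)
  also have "\<dots> = 0"
    using sum_shift'[of g r s "(1, 0)" "(0, 1)"] sum_shift'[of g r s "(0, 1)" "(1, 0)"] by simp
  finally show ?thesis .
qed

lemma sum_face_sign_diff:
  assumes "2 \<le> r" "2 \<le> s"
    and "\<And>t. t \<in> torus_triangles r s \<Longrightarrow>
      face_sign \<tau> (map_triple f t) - face_sign \<tau>' (map_triple f t) = c * boundary_sign a b (map_triple f t)"
  shows "degree_at r s f \<tau> = degree_at r s f \<tau>'"
proof -
  have "degree_at r s f \<tau> - degree_at r s f \<tau>' =
      (\<Sum>t\<in>torus_triangles r s. c * boundary_sign a b (map_triple f t))"
    unfolding degree_at_sum sum_subtractf[symmetric] using assms(3) by (rule sum.cong[OF refl])
  also have "\<dots> = 0"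
    by (simp add: sum_distrib_left[symmetric] sum_boundary_sign[OF assms(1,2)])
  finally show ?thesis by simp
qed

lemma colored_triangle:
  assumes "f \<in> colorings (torus_graph r s) 4" "t \<in> torus_triangles r s"
  obtains c d e where "map_triple f t = (c, d, e)"
    "c \<in> {1, 2, 3, 4}" "d \<in> {1, 2, 3, 4}" "e \<in> {1, 2, 3, 4}" "c \<noteq> d" "d \<noteq> e" "c \<noteq> e"
proof -
  have mem: "shift r s d v \<in> torus_verts r s" if "v \<in> torus_verts r s" for d v
    using that shift_bij[of r s d] by (auto simp: bij_betw_def)
  have col: "f v \<in> {1, 2, 3, 4}" if "v \<in> torus_verts r s" for v
  proof -
    have "f v \<in> {1..4}"
      using assms(1) that by (auto simp: colorings_def torus_graph_def)
    then show ?thesis by auto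
  qed
  have ne: "f v \<noteq> f (shift r s d v)" if "v \<in> torus_verts r s" "d \<in> {(1, 0), (0, 1), (1, 1)}" for v d
  proof -
    have "{v, shift r s d v} \<in> edges (torus_graph r s)"
      using that unfolding torus_graph_def graph.simps by blast
    then show ?thesis
      using assms(1) unfolding colorings_def by blast
  qed
  from assms(2) obtain v where v: "v \<in> torus_verts r s" and
    t: "t = (v, shift r s (1, 0) v, shift r s (1, 1) v) \<or> t = (v, shift r s (1, 1) v, shift r s (0, 1) v)"
    unfolding torus_triangles_def by blast
  have 1: "shift r s (0, 1) (shift r s (1, 0) v) = shift r s (1, 1) v"
    and 2: "shift r s (1, 0) (shift r s (0, 1) v) = shift r s (1, 1) v"
    by (simp_all add: shift_shift)
  have n: "f v \<noteq> f (shift r s (1, 0) v)" "f v \<noteq> f (shift r s (0, 1) v)" "f v \<noteq> f (shift r s (1, 1) v)"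
      "f (shift r s (1, 0) v) \<noteq> f (shift r s (1, 1) v)" "f (shift r s (0, 1) v) \<noteq> f (shift r s (1, 1) v)"
    using ne[OF v, of "(1, 0)"] ne[OF v, of "(0, 1)"] ne[OF v, of "(1, 1)"]
      ne[OF mem[OF v], of "(0, 1)" "(1, 0)"] ne[OF mem[OF v], of "(1, 0)" "(0, 1)"]
    by (simp_all add: 1 2)
  from t show thesis
  proof
    assume "t = (v, shift r s (1, 0) v, shift r s (1, 1) v)"
    then show thesis
      using that[of "f v" "f (shift r s (1, 0) v)" "f (shift r s (1, 1) v)"] n col mem v by auto
  next
    assume "t = (v, shift r s (1, 1) v, shift r s (0, 1) v)"
    then show thesis
      using that[of "f v" "f (shift r s (1, 1) v)" "f (shift r s (0, 1) v)"] n col mem v by auto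
  qed
qed

lemma degree_at_independent:
  assumes "2 \<le> r" "2 \<le> s" "f \<in> colorings (torus_graph r s) 4" "\<tau> \<in> tetra_faces"
  shows "degree_at r s f \<tau> = coloring_degree r s f"
proof -
  note s = face_sign_def edge_sign_def
  have 1: "degree_at r s f (1, 4, 3) = degree_at r s f (2, 3, 4)"
    by (rule sum_face_sign_diff[OF assms(1,2), where a = 3 and b = 4 and c = "-1"],
        erule colored_triangle[OF assms(3)], elim insertE emptyE; simp add: s)
  have 2: "degree_at r s f (1, 2, 4) = degree_at r s f (2, 3, 4)"
    by (rule sum_face_sign_diff[OF assms(1,2), where a = 2 and b = 4 and c = 1],
        erule colored_triangle[OF assms(3)], elim insertE emptyE; simp add: s)
  have 3: "degree_at r s f (1, 3, 2) = degree_at r s f (2, 3, 4)"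
    by (rule sum_face_sign_diff[OF assms(1,2), where a = 2 and b = 3 and c = "-1"],
        erule colored_triangle[OF assms(3)], elim insertE emptyE; simp add: s)
  show ?thesis
    using assms(4) 1 2 3 by (auto simp: tetra_faces_def coloring_degree_def)
qed

end

theory Submission
  imports Defs
begin

text \<open>The degree modulo 12 is invariant under Kempe changes. Modulo 3 it vanishes: the edges of the
  tetrahedron fall into three pairs of opposite edges, the orientation of a face is the cyclic order
  in which its edges meet these pairs, and since \<open>x + y\<close> is a 3-coloring of the torus modulo 3,
  this order is, modulo 3, a sum of contributions of the edges that cancel between adjacent triangles. Modulo 4,
  interchanging \<open>a\<close> and \<open>b\<close> on \<open>W\<close> changes the degree by twice the number of triangles colored
  \<open>a\<close>, \<open>b\<close>, \<open>c\<close> whose vertex of color \<open>a\<close> lies in \<open>W\<close>, and this number is even because every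
  vertex lies in six triangles and every edge in two. As a coloring with three colors has degree
  0, a coloring of degree 6 modulo 12 is not Kempe equivalent to it.\<close>

section \<open>Vertex sets on which two colors may be interchanged\<close>

text \<open>One notion covers a Kempe component, the random union of components in a WSK step, and
  the whole vertex set, where a swap is a global transposition of colors. Vertices of other colors
  may lie in \<open>W\<close>, since the swap fixes them.\<close>

definition kempe_closed :: "'a graph \<Rightarrow> ('a \<Rightarrow> nat) \<Rightarrow> nat \<Rightarrow> nat \<Rightarrow> 'a set \<Rightarrow> bool" where
  "kempe_closed G f a b W \<longleftrightarrow> W \<subseteq> verts G \<and>
     (\<forall>u v. {u, v} \<in> edges G \<longrightarrow> f u \<in> {a, b} \<longrightarrow> f v \<in> {a, b} \<longrightarrow> u \<in> W \<longrightarrow> v \<in> W)"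

lemma kempe_closed_verts:
  assumes "\<And>u v. {u, v} \<in> edges G \<Longrightarrow> u \<in> verts G \<and> v \<in> verts G"
  shows "kempe_closed G f a b (verts G)"
  using assms by (auto simp: kempe_closed_def)

lemma kempe_closed_Union:
  assumes "\<C> \<subseteq> kempe_components G f a b"
    and edges: "\<And>u v. {u, v} \<in> edges G \<Longrightarrow> u \<in> verts G \<and> v \<in> verts G"
  shows "kempe_closed G f a b (\<Union>\<C>)"
proof -
  let ?W = "{v \<in> verts G. f v = a \<or> f v = b}"
  have comp: "\<exists>z\<in>?W. C = (induced_adj G ?W)\<^sup>* `` {z}" if "C \<in> \<C>" for C
    using that assms(1) unfolding kempe_components_def graph_components_def quotient_def by auto
  have reach: "y \<in> ?W" if "(z, y) \<in> (induced_adj G ?W)\<^sup>*" "z \<in> ?W" for z y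
    using that by (induction rule: rtrancl_induct) (auto simp: induced_adj_def)
  have "\<Union>\<C> \<subseteq> verts G"
    using comp reach by blast
  moreover have "v \<in> \<Union>\<C>" if e: "{u, v} \<in> edges G" and c: "f u \<in> {a, b}" "f v \<in> {a, b}" and u: "u \<in> \<Union>\<C>" for u v
  proof -
    obtain C z where C: "C \<in> \<C>" "u \<in> C" "C = (induced_adj G ?W)\<^sup>* `` {z}"
      using u comp by blast
    have "(u, v) \<in> induced_adj G ?W"
      using e c edges[OF e] by (auto simp: induced_adj_def)
    then have "v \<in> C"
      using C by (auto intro: rtrancl_into_rtrancl)
    with C show ?thesis by blast
  qed
  ultimately show ?thesis
    unfolding kempe_closed_def by blast
qed

text \<open>An edge with both colors in \<open>{a, b}\<close> has both ends in \<open>W\<close> or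
  neither, so its colors stay distinct. On any other edge at most one color is in
  \<open>{a, b}\<close>, and a swap never moves a color into or out of that set.\<close>

lemma swap_on_colorings:
  assumes f: "f \<in> colorings G q" and ab: "a \<in> {1..q}" "b \<in> {1..q}" and W: "kempe_closed G f a b W"
  shows "swap_on W a b f \<in> colorings G q"
proof -
  have fv: "f \<in> verts G \<rightarrow>\<^sub>E {1..q}" and fe: "\<And>u v. {u, v} \<in> edges G \<Longrightarrow> f u \<noteq> f v"
    using f by (auto simp: colorings_def)
  have "swap_on W a b f \<in> verts G \<rightarrow>\<^sub>E {1..q}"
  proof (rule PiE_I)
    fix v assume "v \<in> verts G"
    then show "swap_on W a b f v \<in> {1..q}"
      using PiE_mem[OF fv, of v] ab by (auto simp: swap_on_def Transposition.transpose_def)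
  next
    fix v assume "v \<notin> verts G"
    then show "swap_on W a b f v = undefined"
      using PiE_arb[OF fv] W by (auto simp: swap_on_def kempe_closed_def)
  qed
  moreover have "swap_on W a b f u \<noteq> swap_on W a b f v" if e: "{u, v} \<in> edges G" for u v
  proof -
    have "{v, u} \<in> edges G" using e by (simp add: insert_commute)
    then have "u \<in> W \<longleftrightarrow> v \<in> W" if "f u \<in> {a, b}" "f v \<in> {a, b}"
      using W e that unfolding kempe_closed_def by blast
    then show ?thesis
      using fe[OF e] by (auto simp: swap_on_def Transposition.transpose_def)
  qed
  ultimately show ?thesis by (auto simp: colorings_def)
qed

lemma finite_colorings: "finite (verts G) \<Longrightarrow> finite (colorings G q)"
  unfolding colorings_def by (rule finite_subset[of _ "verts G \<rightarrow>\<^sub>E {1..q}"]) (auto intro: finite_PiE)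

section \<open>Invariants of Kempe changes\<close>

text \<open>\<open>P\<close> passes along the generating relation, so the class of \<open>f\<close>
  contains only colorings with \<open>P\<close>, while that of \<open>g\<close> contains
  \<open>g\<close>.\<close>

lemma kappa_gt_1:
  assumes fin: "finite (verts G)" and f: "f \<in> colorings G q" and g: "g \<in> colorings G q"
    and "\<not> P g" "P f"
    and inv: "\<And>h k. (h, k) \<in> kempe_step G q \<union> color_perm G q \<Longrightarrow> P h \<Longrightarrow> P k"
  shows "kappa G q > 1"
proof -
  let ?R = "(kempe_step G q \<union> color_perm G q)\<^sup>*"
  have "P k" if "(f, k) \<in> ?R" for k
    using that by (induction rule: rtrancl_induct) (use \<open>P f\<close> inv in blast)+
  with \<open>\<not> P g\<close> have "?R `` {f} \<noteq> ?R `` {g}" by blast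
  then have "card {?R `` {f}, ?R `` {g}} = 2" by simp
  moreover have "card {?R `` {f}, ?R `` {g}} \<le> card (kempe_classes G q)"
  proof (rule card_mono)
    \<comment> \<open>\<open>card\<close> of an infinite set is 0, so the lower bound needs finitely
      many classes.\<close>
    show "finite (kempe_classes G q)"
      unfolding kempe_classes_def quotient_def using finite_colorings[OF fin] by blast
  qed (use f g in \<open>auto simp: kempe_classes_def quotient_def\<close>)
  ultimately show ?thesis by (simp add: kappa_def)
qed

text \<open>Whatever the coins show, a step swaps on a union of components, so the kernel never
  leaves the colorings with \<open>P\<close>; \<open>g\<close> has probability 0 after any number of
  steps.\<close>

lemma not_wsk_ergodic:
  assumes f: "f \<in> colorings G q" and g: "g \<in> colorings G q" and "2 \<le> q"
    and edges: "\<And>u v. {u, v} \<in> edges G \<Longrightarrow> u \<in> verts G \<and> v \<in> verts G"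
    and "\<not> P g" "P f"
    and inv: "\<And>h a b W. \<lbrakk>h \<in> colorings G q; a \<in> {1..q}; b \<in> {1..q}; a \<noteq> b; kempe_closed G h a b W; P h\<rbrakk>
      \<Longrightarrow> P (swap_on W a b h)"
  shows "\<not> wsk_ergodic G q"
proof
  let ?S = "{h \<in> colorings G q. P h}"
  let ?AB = "{(a, b). a \<in> {1..q} \<and> b \<in> {1..q} \<and> a \<noteq> b}"
  have AB: "finite ?AB" "?AB \<noteq> {}"
  proof -
    show "finite ?AB" by (rule finite_subset[of _ "{1..q} \<times> {1..q}"]) auto
    have "(1, 2) \<in> ?AB" using \<open>2 \<le> q\<close> by auto
    then show "?AB \<noteq> {}" by blast
  qed
  have kernel: "set_pmf (wsk_kernel G q h) \<subseteq> ?S" if h: "h \<in> ?S" for h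
  proof
    fix k assume "k \<in> set_pmf (wsk_kernel G q h)"
    then obtain a b s where ab: "a \<in> {1..q}" "b \<in> {1..q}" "a \<noteq> b"
      and k: "k = swap_on (\<Union>{C \<in> kempe_components G h a b. s C}) a b h"
      unfolding wsk_kernel_def using AB by (auto simp: set_pmf_of_set)
    have W: "kempe_closed G h a b (\<Union>{C \<in> kempe_components G h a b. s C})"
      by (rule kempe_closed_Union[OF _ edges]) auto
    show "k \<in> ?S"
      using h ab W by (simp add: k inv swap_on_colorings)
  qed
  have "set_pmf (n_step (wsk_kernel G q) n f) \<subseteq> ?S" for n
  proof (induction n)
    case 0
    then show ?case using f \<open>P f\<close> by (simp add: n_step_def)
  next
    case (Suc n)
    then show ?case using kernel by (fastforce simp: n_step_def)
  qed
  moreover assume "wsk_ergodic G q"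
  then obtain n where "pmf (n_step (wsk_kernel G q) n f) g > 0"
    using f g unfolding wsk_ergodic_def irreducible_chain_def by blast
  then have "g \<in> set_pmf (n_step (wsk_kernel G q) n f)"
    by (simp add: set_pmf_iff)
  ultimately show False using \<open>\<not> P g\<close> by blast
qed

text \<open>A permutation is a product of transpositions, each of which acts as a swap on all
  vertices. The induction carries properness along because \<open>inv\<close> asks for it.\<close>

lemma color_perm_invariant:
  assumes fg: "(f, g) \<in> color_perm G q"
    and edges: "\<And>u v. {u, v} \<in> edges G \<Longrightarrow> u \<in> verts G \<and> v \<in> verts G"
    and "P f"
    and inv: "\<And>h a b W. \<lbrakk>h \<in> colorings G q; a \<in> {1..q}; b \<in> {1..q}; a \<noteq> b; kempe_closed G h a b W; P h\<rbrakk>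
      \<Longrightarrow> P (swap_on W a b h)"
  shows "P g"
proof -
  let ?r = "\<lambda>\<pi>. restrict (\<pi> \<circ> f) (verts G)"
  obtain \<pi> where f: "f \<in> colorings G q" and \<pi>: "\<pi> permutes {1..q}" and g: "g = ?r \<pi>"
    using fg by (auto simp: color_perm_def)
  have "?r \<pi> \<in> colorings G q \<and> P (?r \<pi>)"
    using \<pi> finite_atLeastAtMost
  proof (induction rule: permutes_induct)
    case id
    have "?r id = f" using f by (auto simp: colorings_def)
    then show ?case using f \<open>P f\<close> by simp
  next
    case (swap a b p)
    show ?case
    proof (cases "a = b")
      case False
      have "?r (Transposition.transpose a b \<circ> p) = swap_on (verts G) a b (?r p)"
        by (auto simp: swap_on_def)
      then show ?thesis
        using swap False inv[of "?r p" a b] swap_on_colorings[of "?r p"] kempe_closed_verts[OF edges]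
        by metis
    qed (use swap in simp)
  qed
  then show ?thesis by (simp add: g)
qed

lemma kempe_step_invariant:
  assumes fg: "(f, g) \<in> kempe_step G q"
    and edges: "\<And>u v. {u, v} \<in> edges G \<Longrightarrow> u \<in> verts G \<and> v \<in> verts G"
    and "P f"
    and inv: "\<And>h a b W. \<lbrakk>h \<in> colorings G q; a \<in> {1..q}; b \<in> {1..q}; a \<noteq> b; kempe_closed G h a b W; P h\<rbrakk>
      \<Longrightarrow> P (swap_on W a b h)"
  shows "P g"
proof -
  obtain a b C where "f \<in> colorings G q" "a \<in> {1..q}" "b \<in> {1..q}" "a \<noteq> b"
    and C: "C \<in> kempe_components G f a b" and g: "g = swap_on C a b f"
    using fg by (auto simp: kempe_step_def)
  moreover have "kempe_closed G f a b C"
    using kempe_closed_Union[of "{C}", OF _ edges] C by simp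
  ultimately show ?thesis using inv \<open>P f\<close> by blast
qed

section \<open>The degree modulo 12\<close>

lemma shift_in_torus_verts: "v \<in> torus_verts r s \<Longrightarrow> shift r s d v \<in> torus_verts r s"
  using shift_bij[of r s d] by (auto simp: bij_betw_def)

lemma torus_edge_verts:
  "{u, v} \<in> edges (torus_graph r s) \<Longrightarrow> u \<in> verts (torus_graph r s) \<and> v \<in> verts (torus_graph r s)"
  unfolding torus_graph_def by (auto simp: doubleton_eq_iff shift_in_torus_verts simp del: shift.simps)

lemma torus_triangle_edges:
  assumes "(u, v, w) \<in> torus_triangles r s"
  shows "{u, v} \<in> edges (torus_graph r s)" "{v, w} \<in> edges (torus_graph r s)" "{w, u} \<in> edges (torus_graph r s)"
proof -
  have e: "{x, shift r s d x} \<in> edges (torus_graph r s) \<and> {shift r s d x, x} \<in> edges (torus_graph r s)"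
    if "x \<in> torus_verts r s" "d \<in> {(1, 0), (0, 1), (1, 1)}" for x d
    using that unfolding torus_graph_def graph.simps insert_commute[of "shift r s d x" x] by blast
  have "{shift r s (1, 0) x, shift r s (1, 1) x} \<in> edges (torus_graph r s)"
    "{shift r s (1, 1) x, shift r s (0, 1) x} \<in> edges (torus_graph r s)" if "x \<in> torus_verts r s" for x
    using e[OF shift_in_torus_verts[OF that], of "(0, 1)" "(1, 0)"] e[OF shift_in_torus_verts[OF that], of "(1, 0)" "(0, 1)"]
    by (simp_all add: shift_shift del: shift.simps)
  with e assms show "{u, v} \<in> edges (torus_graph r s)" "{v, w} \<in> edges (torus_graph r s)" "{w, u} \<in> edges (torus_graph r s)"
    unfolding torus_triangles_def by blast+
qed

text \<open>Each vertex lies in six triangles: once as each of the three corners of each of the two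
  kinds of triangle.\<close>

lemma sum_torus_triangles_verts:
  fixes g :: "vertex \<Rightarrow> int"
  assumes "2 \<le> r" "2 \<le> s"
  shows "(\<Sum>(u, v, w)\<in>torus_triangles r s. g u + g v + g w) = 6 * (\<Sum>v\<in>torus_verts r s. g v)"
  unfolding sum_torus_triangles[OF assms] by (simp add: sum.distrib sum_shift sum_distrib_left[symmetric] del: shift.simps)

text \<open>Each edge borders two triangles. The diagonal is shared by the two triangles of a cell;
  for horizontal and vertical edges one of the two sums is a translate of the other.\<close>

lemma sum_torus_triangles_edges:
  fixes g :: "vertex \<Rightarrow> vertex \<Rightarrow> int"
  assumes "2 \<le> r" "2 \<le> s" and sym: "\<And>u v. g u v = g v u"
  shows "even (\<Sum>(u, v, w)\<in>torus_triangles r s. g u v + g v w + g w u)"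
proof -
  let ?V = "torus_verts r s"
  let ?s = "shift r s"
  have "(\<Sum>(u, v, w)\<in>torus_triangles r s. g u v + g v w + g w u) =
    (\<Sum>v\<in>?V. g v (?s (1, 0) v)) + (\<Sum>v\<in>?V. g (?s (1, 0) v) (?s (1, 1) v)) + 2 * (\<Sum>v\<in>?V. g v (?s (1, 1) v))
    + (\<Sum>v\<in>?V. g (?s (0, 1) v) (?s (1, 1) v)) + (\<Sum>v\<in>?V. g v (?s (0, 1) v))"
    unfolding sum_torus_triangles[OF assms(1,2)] sum.distrib[symmetric] sum_distrib_left
  proof (rule sum.cong[OF refl])
    fix v
    show "(case (v, ?s (1, 0) v, ?s (1, 1) v) of (u, v, w) \<Rightarrow> g u v + g v w + g w u) +
        (case (v, ?s (1, 1) v, ?s (0, 1) v) of (u, v, w) \<Rightarrow> g u v + g v w + g w u) =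
        g v (?s (1, 0) v) + g (?s (1, 0) v) (?s (1, 1) v) + 2 * g v (?s (1, 1) v) +
        g (?s (0, 1) v) (?s (1, 1) v) + g v (?s (0, 1) v)"
      using sym[of "?s (1, 1) v" v] sym[of "?s (1, 1) v" "?s (0, 1) v"] sym[of "?s (0, 1) v" v]
      by (simp del: shift.simps)
  qed
  then show ?thesis
    using sum_shift'[of g r s "(1, 0)" "(0, 1)"] sum_shift'[of g r s "(0, 1)" "(1, 0)"] by simp
qed


lemma opposite_mem_rotations_opposite: "(a, c, b) \<in> rotations (opposite \<tau>) \<longleftrightarrow> (a, b, c) \<in> rotations \<tau>"
  by (cases \<tau>) (simp, blast)

lemma opposite_mem_rotations: "(a, c, b) \<in> rotations \<tau> \<longleftrightarrow> (a, b, c) \<in> rotations (opposite \<tau>)"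
  by (cases \<tau>) (simp, blast)

lemma face_sign_opposite: "face_sign \<tau> (a, c, b) = - face_sign \<tau> (a, b, c)"
  using opposite_mem_rotations_opposite[of a c b \<tau>] opposite_mem_rotations[of a c b \<tau>]
  by (simp add: face_sign_def)

lemma degree_at_rotation:
  assumes "\<tau>' \<in> rotations \<tau>"
  shows "degree_at r s f \<tau>' = degree_at r s f \<tau>"
proof -
  obtain a b c where \<tau>: "\<tau> = (a, b, c)" by (cases \<tau>)
  have "rotations \<tau>' = rotations \<tau> \<and> rotations (opposite \<tau>') = rotations (opposite \<tau>)"
    using assms unfolding \<tau> rotations.simps by (elim insertE emptyE; simp; blast)
  then show ?thesis by (simp add: degree_at_def)
qed

lemma degree_at_tetra_rotation:
  assumes "2 \<le> r" "2 \<le> s" "f \<in> colorings (torus_graph r s) 4" "\<tau> \<in> tetra_faces" "\<tau>' \<in> rotations \<tau>"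
  shows "degree_at r s f \<tau>' = coloring_degree r s f"
  using degree_at_rotation[OF assms(5)] degree_at_independent[OF assms(1-4)] by simp

section \<open>Divisibility of the degree by 3\<close>

text \<open>On distinct colors from 1 to 4 the values 0, 1, 2 distinguish the three pairs of opposite edges of
  the tetrahedron.\<close>

definition tait_color :: "nat \<Rightarrow> nat \<Rightarrow> int" where
  "tait_color a b = \<bar>int a + int b - 5\<bar>"

text \<open>Exactly one face contributes, with sign 1 or -1. The three values of
  \<open>tait_color\<close> are 0, 1, 2 in some order with sum 3, so \<open>k\<close> drops out
  modulo 3; what remains is the difference of two of them, which is 1 or -1 according to their
  cyclic order.\<close>

lemma sum_face_sign_tait:
  assumes "a \<in> {1, 2, 3, 4}" "b \<in> {1, 2, 3, 4}" "c \<in> {1, 2, 3, 4}" "a \<noteq> b" "b \<noteq> c" "a \<noteq> c"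
  shows "[(\<Sum>\<tau>\<in>tetra_faces. face_sign \<tau> (a, b, c)) =
    k * tait_color a b + (k + 1) * tait_color b c + (k + 2) * tait_color c a] (mod 3)"
  using assms unfolding cong_iff_dvd_diff
  by (elim insertE emptyE; simp add: tetra_faces_def face_sign_def tait_color_def)

lemma cong_shift_sum:
  assumes "n dvd r" "n dvd s"
  shows "[fst (shift r s d v) + snd (shift r s d v) = fst v + snd v + (fst d + snd d)] (mod n)"
proof -
  obtain x y i j where vd: "v = (x, y)" "d = (i, j)" by fastforce
  have "[(x + i) mod r = x + i] (mod n)" "[(y + j) mod s = y + j] (mod n)"
    using assms by (simp_all add: cong_def mod_mod_cancel)
  from cong_add[OF this] show ?thesis by (simp add: vd algebra_simps)
qed

lemma sum_tetra_faces_degree_at: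
  assumes "2 \<le> r" "2 \<le> s" "f \<in> colorings (torus_graph r s) 4"
  shows "(\<Sum>\<tau>\<in>tetra_faces. degree_at r s f \<tau>) = 4 * coloring_degree r s f"
  using degree_at_independent[OF assms] by (simp add: tetra_faces_def)

lemma colored_torus_triangle:
  assumes "f \<in> colorings (torus_graph r s) 4" "(u, v, w) \<in> torus_triangles r s"
  shows "f u \<in> {1, 2, 3, 4} \<and> f v \<in> {1, 2, 3, 4} \<and> f w \<in> {1, 2, 3, 4} \<and> f u \<noteq> f v \<and> f v \<noteq> f w \<and> f u \<noteq> f w"
  by (rule colored_triangle[OF assms]) simp

lemma three_dvd_coloring_degree:
  assumes "2 \<le> r" "2 \<le> s" "3 dvd r" "3 dvd s" and f: "f \<in> colorings (torus_graph r s) 4"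
  shows "3 dvd coloring_degree r s f"
proof -
  let ?V = "torus_verts r s"
  let ?s = "shift r s"
  define l where "l v = fst v + snd v" for v :: vertex
  \<comment> \<open>The factor \<open>k\<close>, \<open>k + 1\<close> or \<open>k + 2\<close> of an
    edge becomes the label of its tail, so that the term depends on the directed edge alone.\<close>
  define g where "g u v = l u * tait_color (f u) (f v)" for u v
  define F where "F t = (\<Sum>\<tau>\<in>tetra_faces. face_sign \<tau> t)" for t
  have l: "[l (?s d v) = l v + (fst d + snd d)] (mod 3)" for d v
    using cong_shift_sum[OF assms(3,4)] by (simp add: l_def)
  \<comment> \<open>Labels rise by 1 modulo 3 at every step around \<open>u\<close>,
    \<open>v\<close>, \<open>w\<close>. This path may run either way round the triangle, since
    \<open>F\<close> sees only the colors in the order listed.\<close>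
  have F: "[F (f u, f v, f w) = g u v + g v w + g w u] (mod 3)"
    if t: "(u, v, w) \<in> torus_triangles r s \<or> (u, w, v) \<in> torus_triangles r s"
      and lab: "[l v = l u + 1] (mod 3)" "[l w = l u + 2] (mod 3)" for u v w
  proof -
    have "f u \<in> {1, 2, 3, 4}" "f v \<in> {1, 2, 3, 4}" "f w \<in> {1, 2, 3, 4}" "f u \<noteq> f v" "f v \<noteq> f w" "f u \<noteq> f w"
      using t colored_torus_triangle[OF f, of u v w] colored_torus_triangle[OF f, of u w v] by argo+
    then have "[F (f u, f v, f w) = l u * tait_color (f u) (f v) + (l u + 1) * tait_color (f v) (f w) +
        (l u + 2) * tait_color (f w) (f u)] (mod 3)"
      unfolding F_def by (rule sum_face_sign_tait)
    also have "[l u * tait_color (f u) (f v) + (l u + 1) * tait_color (f v) (f w) +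
        (l u + 2) * tait_color (f w) (f u) = g u v + g v w + g w u] (mod 3)"
      unfolding g_def by (intro cong_add cong_mult cong_refl cong_sym[OF lab(1)] cong_sym[OF lab(2)])
    finally show ?thesis .
  qed
  \<comment> \<open>Following rising labels from \<open>v\<close>, the two triangles of a cell are
    traversed in opposite senses, so their diagonal terms cancel.\<close>
  have cell: "[F (map_triple f (v, ?s (1, 0) v, ?s (1, 1) v)) + F (map_triple f (v, ?s (1, 1) v, ?s (0, 1) v)) =
      g v (?s (1, 0) v) + g (?s (1, 0) v) (?s (1, 1) v) - g v (?s (0, 1) v) - g (?s (0, 1) v) (?s (1, 1) v)] (mod 3)"
    if v: "v \<in> ?V" for v
  proof -
    have t: "(v, ?s (1, 0) v, ?s (1, 1) v) \<in> torus_triangles r s" "(v, ?s (1, 1) v, ?s (0, 1) v) \<in> torus_triangles r s"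
      using v unfolding torus_triangles_def by blast+
    have "[F (f v, f (?s (1, 0) v), f (?s (1, 1) v)) =
        g v (?s (1, 0) v) + g (?s (1, 0) v) (?s (1, 1) v) + g (?s (1, 1) v) v] (mod 3)"
      using F[OF disjI1[OF t(1)]] l[of "(1, 0)" v] l[of "(1, 1)" v] by simp
    moreover have "[F (f v, f (?s (0, 1) v), f (?s (1, 1) v)) =
        g v (?s (0, 1) v) + g (?s (0, 1) v) (?s (1, 1) v) + g (?s (1, 1) v) v] (mod 3)"
      using F[OF disjI2[OF t(2)]] l[of "(0, 1)" v] l[of "(1, 1)" v] by simp
    ultimately have "[F (f v, f (?s (1, 0) v), f (?s (1, 1) v)) - F (f v, f (?s (0, 1) v), f (?s (1, 1) v)) =
        (g v (?s (1, 0) v) + g (?s (1, 0) v) (?s (1, 1) v) + g (?s (1, 1) v) v) -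
        (g v (?s (0, 1) v) + g (?s (0, 1) v) (?s (1, 1) v) + g (?s (1, 1) v) v)] (mod 3)"
      by (rule cong_diff)
    moreover have "F (f v, f (?s (1, 1) v), f (?s (0, 1) v)) = - F (f v, f (?s (0, 1) v), f (?s (1, 1) v))"
      unfolding F_def by (subst face_sign_opposite) (rule sum_negf)
    ultimately show ?thesis by (simp add: algebra_simps)
  qed
  have cancel: "(\<Sum>v\<in>?V. g v (?s (1, 0) v) + g (?s (1, 0) v) (?s (1, 1) v) - g v (?s (0, 1) v)
      - g (?s (0, 1) v) (?s (1, 1) v)) = 0"
    using sum_shift'[of g r s "(1, 0)" "(0, 1)"] sum_shift'[of g r s "(0, 1)" "(1, 0)"]
    unfolding sum_subtractf sum.distrib by simp
  \<comment> \<open>Summing over all four faces multiplies the degree by 4, which is invertible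
    modulo 3.\<close>
  have "4 * coloring_degree r s f = (\<Sum>t\<in>torus_triangles r s. F (map_triple f t))"
    unfolding sum_tetra_faces_degree_at[OF assms(1,2) f, symmetric] degree_at_sum F_def by (rule sum.swap)
  also have "\<dots> = (\<Sum>v\<in>?V. F (map_triple f (v, ?s (1, 0) v, ?s (1, 1) v)) + F (map_triple f (v, ?s (1, 1) v, ?s (0, 1) v)))"
    by (rule sum_torus_triangles[OF assms(1,2)])
  finally have "[4 * coloring_degree r s f = 0] (mod 3)"
    using cong_sum[OF cell, of ?V "\<lambda>v. v"] by (simp only: cancel)
  then have "3 dvd 4 * coloring_degree r s f" by (simp only: cong_0_iff)
  then show ?thesis by presburger
qed

section \<open>Invariance of the degree modulo 4\<close>

text \<open>The right-hand side counts the triangles with a vertex of color \<open>a\<close> in \<open>W\<close>, except those in which this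
  vertex is joined to a vertex of color \<open>d\<close>.\<close>

lemma face_sign_swap:
  fixes a b c d p q t :: nat and A :: "bool \<Rightarrow> nat \<Rightarrow> int"
  defines "A \<equiv> \<lambda>w x. of_bool (w \<and> x = a)"
  defines "S \<equiv> \<lambda>w x. if w then Transposition.transpose a b x else x"
  defines "E \<equiv> \<lambda>w x w' y. A w x * of_bool (y = d) + A w' y * of_bool (x = d)"
  assumes "distinct [a, b, c, d]" "p \<in> {a, b, c, d}" "q \<in> {a, b, c, d}" "t \<in> {a, b, c, d}"
    and "p \<noteq> q" "q \<noteq> t" "p \<noteq> t"
    and "p \<in> {a, b} \<Longrightarrow> q \<in> {a, b} \<Longrightarrow> u \<longleftrightarrow> v"
    and "q \<in> {a, b} \<Longrightarrow> t \<in> {a, b} \<Longrightarrow> v \<longleftrightarrow> w"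
    and "t \<in> {a, b} \<Longrightarrow> p \<in> {a, b} \<Longrightarrow> w \<longleftrightarrow> u"
  shows "[face_sign (a, b, c) (S u p, S v q, S w t) - face_sign (a, b, c) (p, q, t) =
     2 * (A u p + A v q + A w t) - 2 * (E u p v q + E v q w t + E w t u p)] (mod 4)"
proof -
  have neq: "a \<noteq> b" "b \<noteq> a" "a \<noteq> c" "c \<noteq> a" "a \<noteq> d" "d \<noteq> a" "b \<noteq> c" "c \<noteq> b" "b \<noteq> d" "d \<noteq> b" "c \<noteq> d" "d \<noteq> c"
    using assms(4) by auto
  have S: "S w a = (if w then b else a)" "S w b = (if w then a else b)" "S w c = c" "S w d = d" for w
    using neq by (simp_all add: S_def)
  have A: "A w a = of_bool w" "A w b = 0" "A w c = 0" "A w d = 0" for w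
    using neq by (simp_all add: A_def)
  \<comment> \<open>On a triangle colored \<open>a\<close>, \<open>b\<close>, \<open>c\<close> the
    swap reverses the sign, a change of 2 or -2, equal modulo 4. On other triangles the sign is 0
    before and after, and any vertex counted by \<open>A\<close> has exactly one neighbor of color
    \<open>d\<close> there, so the two terms cancel.\<close>
  from assms(5-13) show ?thesis
    by (elim insertE emptyE) (simp_all only: simp_thms S A E_def, simp_all add: neq,
        (cases u; cases v; cases w; simp add: face_sign_def neq cong_def)+)
qed

text \<open>Summed over all triangles, the local formula gives 12 times the sum of \<open>A\<close>
  minus twice an even edge sum, which vanishes modulo 4.\<close>

lemma degree_at_swap_on:
  assumes "2 \<le> r" "2 \<le> s" and f: "f \<in> colorings (torus_graph r s) 4"
    and W: "kempe_closed (torus_graph r s) f a b W"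
    and dist: "distinct [a, b, c, d]" and set: "{a, b, c, d} = {1, 2, 3, 4}"
  shows "[degree_at r s (swap_on W a b f) (a, b, c) = degree_at r s f (a, b, c)] (mod 4)"
proof -
  let ?T = "torus_triangles r s"
  let ?g = "swap_on W a b f"
  define A :: "vertex \<Rightarrow> int" where "A v = of_bool (v \<in> W \<and> f v = a)" for v
  define E :: "vertex \<Rightarrow> vertex \<Rightarrow> int" where "E u v = A u * of_bool (f v = d) + A v * of_bool (f u = d)" for u v
  have tri: "[face_sign (a, b, c) (map_triple ?g t) - face_sign (a, b, c) (map_triple f t) =
      (case t of (u, v, w) \<Rightarrow> 2 * (A u + A v + A w) - 2 * (E u v + E v w + E w u))] (mod 4)"
    if t: "t \<in> ?T" for t
  proof -
    obtain u v w where uvw: "t = (u, v, w)" by (cases t)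
    have closed: "y \<in> W \<longleftrightarrow> z \<in> W" if "{y, z} \<in> edges (torus_graph r s)" "f y \<in> {a, b}" "f z \<in> {a, b}" for y z
      using W that that(1)[unfolded insert_commute[of y z]] unfolding kempe_closed_def by blast
    note e = torus_triangle_edges[OF t[unfolded uvw]]
    have "[face_sign (a, b, c) (map_triple ?g (u, v, w)) - face_sign (a, b, c) (map_triple f (u, v, w)) =
      2 * (A u + A v + A w) - 2 * (E u v + E v w + E w u)] (mod 4)"
      unfolding map_triple.simps A_def E_def swap_on_def
      using colored_torus_triangle[OF f t[unfolded uvw]] closed[OF e(1)] closed[OF e(2)] closed[OF e(3)]
      by (intro face_sign_swap dist) (simp_all only: set, blast+)
    then show ?thesis by (simp only: uvw prod.case)
  qed
  have "degree_at r s ?g (a, b, c) - degree_at r s f (a, b, c) =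
      (\<Sum>t\<in>?T. face_sign (a, b, c) (map_triple ?g t) - face_sign (a, b, c) (map_triple f t))"
    by (simp add: degree_at_sum sum_subtractf)
  also have "[\<dots> = (\<Sum>t\<in>?T. case t of (u, v, w) \<Rightarrow> 2 * (A u + A v + A w) - 2 * (E u v + E v w + E w u))] (mod 4)"
    by (intro cong_sum tri)
  also have "(\<Sum>t\<in>?T. case t of (u, v, w) \<Rightarrow> 2 * (A u + A v + A w) - 2 * (E u v + E v w + E w u)) =
      2 * (\<Sum>(u, v, w)\<in>?T. A u + A v + A w) - 2 * (\<Sum>(u, v, w)\<in>?T. E u v + E v w + E w u)"
    unfolding sum_distrib_left sum_subtractf[symmetric] by (intro sum.cong) auto
  also have "[\<dots> = 0] (mod 4)"
  proof -
    have "even (\<Sum>(u, v, w)\<in>?T. E u v + E v w + E w u)"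
      by (rule sum_torus_triangles_edges[OF assms(1,2)]) (simp add: E_def)
    then show ?thesis
      unfolding sum_torus_triangles_verts[OF assms(1,2)] cong_0_iff by presburger
  qed
  finally show ?thesis by (simp add: cong_diff_iff_cong_0)
qed

text \<open>Two faces meet in each edge of the tetrahedron and traverse it in opposite directions,
  so one of them runs from \<open>a\<close> to \<open>b\<close>.\<close>

lemma third_color:
  assumes "a \<in> {1..4::nat}" "b \<in> {1..4}" "a \<noteq> b"
  obtains c d \<tau> where "distinct [a, b, c, d]" "{a, b, c, d} = {1, 2, 3, 4}"
    "\<tau> \<in> tetra_faces" "(a, b, c) \<in> rotations \<tau>"
proof -
  have "a \<in> {1, 2, 3, 4}" "b \<in> {1, 2, 3, 4}"
    using assms(1,2) by auto
  then have "\<exists>\<tau>\<in>tetra_faces. \<exists>c. (a, b, c) \<in> rotations \<tau>"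
    using \<open>a \<noteq> b\<close> by (elim insertE emptyE) (simp_all add: tetra_faces_def)
  then obtain \<tau> c where \<tau>: "\<tau> \<in> tetra_faces" "(a, b, c) \<in> rotations \<tau>" by blast
  \<comment> \<open>The four colors add up to 10, which determines the remaining one.\<close>
  then have "distinct [a, b, c, 10 - a - b - c] \<and> {a, b, c, 10 - a - b - c} = {1, 2, 3, 4}"
    unfolding tetra_faces_def
    by (elim insertE emptyE) (simp_all only: rotations.simps, (elim insertE emptyE, auto)+)
  with \<tau> that show thesis by blast
qed

text \<open>Independence of the face carries the congruence modulo 4 from the face through
  \<open>a\<close> and \<open>b\<close> to \<open>coloring_degree\<close>. Both degrees are
  divisible by 3, and 3 and 4 are coprime.\<close>

lemma coloring_degree_swap_on:
  assumes rs: "2 \<le> r" "2 \<le> s" "3 dvd r" "3 dvd s"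
    and f: "f \<in> colorings (torus_graph r s) 4" and ab: "a \<in> {1..4}" "b \<in> {1..4}" "a \<noteq> b"
    and W: "kempe_closed (torus_graph r s) f a b W"
  shows "[coloring_degree r s (swap_on W a b f) = coloring_degree r s f] (mod 12)"
proof -
  have g: "swap_on W a b f \<in> colorings (torus_graph r s) 4"
    using swap_on_colorings f ab(1,2) W by blast
  obtain c d \<tau> where c: "distinct [a, b, c, d]" "{a, b, c, d} = {1, 2, 3, 4}" "\<tau> \<in> tetra_faces" "(a, b, c) \<in> rotations \<tau>"
    using third_color[OF ab] .
  have "[coloring_degree r s (swap_on W a b f) = coloring_degree r s f] (mod 4)"
    using degree_at_swap_on[OF rs(1,2) f W c(1,2)] degree_at_tetra_rotation[OF rs(1,2) _ c(3,4)] f g by simp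
  moreover have "3 dvd coloring_degree r s (swap_on W a b f)" "3 dvd coloring_degree r s f"
    by (rule three_dvd_coloring_degree[OF rs f] three_dvd_coloring_degree[OF rs g])+
  ultimately show ?thesis
    unfolding cong_iff_dvd_diff by presburger
qed

section \<open>Colorings obtained from finite patterns\<close>

text \<open>A coloring that sees the coordinates \<open>x\<close>, \<open>y\<close> only through the indices \<open>\<phi> x\<close>, \<open>\<phi> y\<close> of a finite
  pattern \<open>T\<close>. The index of \<open>x + 1\<close> need not be \<open>\<sigma> (\<phi> x)\<close>, but it must select the same column and row
  of \<open>T\<close>.\<close>

locale torus_pattern =
  fixes N :: int and m :: nat and T :: "nat \<Rightarrow> nat \<Rightarrow> nat" and \<phi> :: "int \<Rightarrow> nat" and \<sigma> :: "nat \<Rightarrow> nat"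
  assumes N: "2 \<le> N"
    and \<phi>: "\<phi> x < m"
    and \<sigma>: "i < m \<Longrightarrow> \<sigma> i < m"
    and column: "\<lbrakk>0 \<le> x; x < N; j < m\<rbrakk> \<Longrightarrow> T (\<phi> ((x + 1) mod N)) j = T (\<sigma> (\<phi> x)) j"
    and row: "\<lbrakk>0 \<le> y; y < N; i < m\<rbrakk> \<Longrightarrow> T i (\<phi> ((y + 1) mod N)) = T i (\<sigma> (\<phi> y))"
    and color: "\<lbrakk>i < m; j < m\<rbrakk> \<Longrightarrow> T i j \<in> {1..4}"
    and proper: "\<lbrakk>i < m; j < m\<rbrakk> \<Longrightarrow> T i j \<noteq> T (\<sigma> i) j \<and> T i j \<noteq> T i (\<sigma> j) \<and> T i j \<noteq> T (\<sigma> i) (\<sigma> j)"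
begin

definition pattern_coloring :: "vertex \<Rightarrow> nat" where
  "pattern_coloring = restrict (\<lambda>(x, y). T (\<phi> x) (\<phi> y)) (torus_verts N N)"

text \<open>The part of the degree due to one unit square. Using \<open>\<sigma>\<close> for the
  next index makes it depend on \<open>i\<close> and \<open>j\<close> only, hence
  computable.\<close>

definition cell_degree :: "nat \<Rightarrow> nat \<Rightarrow> int" where
  "cell_degree i j = face_sign (2, 3, 4) (T i j, T (\<sigma> i) j, T (\<sigma> i) (\<sigma> j)) +
     face_sign (2, 3, 4) (T i j, T (\<sigma> i) (\<sigma> j), T i (\<sigma> j))"

lemma pattern_coloring_shift:
  assumes "(x, y) \<in> torus_verts N N"
  shows "pattern_coloring (x, y) = T (\<phi> x) (\<phi> y)"
    "pattern_coloring (shift N N (1, 0) (x, y)) = T (\<sigma> (\<phi> x)) (\<phi> y)"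
    "pattern_coloring (shift N N (0, 1) (x, y)) = T (\<phi> x) (\<sigma> (\<phi> y))"
    "pattern_coloring (shift N N (1, 1) (x, y)) = T (\<sigma> (\<phi> x)) (\<sigma> (\<phi> y))"
proof -
  have xy: "0 \<le> x" "x < N" "0 \<le> y" "y < N" using assms by (auto simp: torus_verts_def)
  have "pattern_coloring (shift N N d (x, y)) = T (\<phi> ((x + fst d) mod N)) (\<phi> ((y + snd d) mod N))" for d
    using shift_in_torus_verts[OF assms, of d] by (cases d) (simp add: pattern_coloring_def)
  from this[of "(1, 0)"] this[of "(0, 1)"] this[of "(1, 1)"] show
    "pattern_coloring (shift N N (1, 0) (x, y)) = T (\<sigma> (\<phi> x)) (\<phi> y)"
    "pattern_coloring (shift N N (0, 1) (x, y)) = T (\<phi> x) (\<sigma> (\<phi> y))"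
    "pattern_coloring (shift N N (1, 1) (x, y)) = T (\<sigma> (\<phi> x)) (\<sigma> (\<phi> y))"
    using xy \<phi> \<sigma> by (simp_all add: column row)
  show "pattern_coloring (x, y) = T (\<phi> x) (\<phi> y)"
    using assms by (simp add: pattern_coloring_def)
qed

lemma pattern_coloring: "pattern_coloring \<in> colorings (torus_graph N N) 4"
proof -
  have "pattern_coloring \<in> torus_verts N N \<rightarrow>\<^sub>E {1..4}"
    using color \<phi> by (auto simp: pattern_coloring_def simp del: atLeastAtMost_iff)
  moreover have "pattern_coloring v \<noteq> pattern_coloring (shift N N d v)"
    if "v \<in> torus_verts N N" "d \<in> {(1, 0), (0, 1), (1, 1)}" for v d
  proof -
    obtain x y where v: "v = (x, y)" by (cases v)
    show ?thesis
      using that(2) pattern_coloring_shift[OF that(1)[unfolded v]] proper[OF \<phi> \<phi>, of x y] v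
      by (elim insertE emptyE) (simp_all del: shift.simps)
  qed
  then have "pattern_coloring u \<noteq> pattern_coloring v" if "{u, v} \<in> edges (torus_graph N N)" for u v
    using that unfolding torus_graph_def graph.simps mem_Collect_eq doubleton_eq_iff by metis
  ultimately show ?thesis
    by (simp add: colorings_def torus_graph_def)
qed

lemma coloring_degree_pattern_coloring:
  "coloring_degree N N pattern_coloring = (\<Sum>x\<in>{0..<N}. \<Sum>y\<in>{0..<N}. cell_degree (\<phi> x) (\<phi> y))"
proof -
  have "coloring_degree N N pattern_coloring = (\<Sum>(x, y)\<in>torus_verts N N. cell_degree (\<phi> x) (\<phi> y))"
    unfolding coloring_degree_def degree_at_sum sum_torus_triangles[OF N N]
  proof (rule sum.cong[OF refl])
    fix v assume v: "v \<in> torus_verts N N"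
    obtain x y where xy: "v = (x, y)" by (cases v)
    show "face_sign (2, 3, 4) (map_triple pattern_coloring (v, shift N N (1, 0) v, shift N N (1, 1) v)) +
        face_sign (2, 3, 4) (map_triple pattern_coloring (v, shift N N (1, 1) v, shift N N (0, 1) v)) =
        (case v of (x, y) \<Rightarrow> cell_degree (\<phi> x) (\<phi> y))"
      using pattern_coloring_shift[OF v[unfolded xy]] by (simp add: xy cell_degree_def del: shift.simps)
  qed
  then show ?thesis
    by (simp add: torus_verts_def sum.cartesian_product)
qed

end

section \<open>Explicit colorings of degree 0 and of degree 6 modulo 12\<close>

text \<open>As 3 divides \<open>N\<close>, \<open>1 + (x + y) mod 3\<close> is well defined and
  proper on the torus. It omits color 4, so no triangle maps onto the face
  \<open>(2, 3, 4)\<close>.\<close>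

lemma three_coloring:
  assumes "3 dvd N" "2 \<le> N"
  obtains f where "f \<in> colorings (torus_graph N N) 4" "coloring_degree N N f = 0"
proof -
  let ?T = "\<lambda>i j. 1 + (i + j) mod 3 :: nat"
  have succ: "nat ((x + 1) mod N mod 3) = Suc (nat (x mod 3)) mod 3" for x
  proof -
    have "(x + 1) mod N mod 3 = (x mod 3 + 1) mod 3"
      using assms(1) by (simp add: mod_mod_cancel mod_add_left_eq)
    then show ?thesis by (simp add: nat_mod_distrib nat_add_distrib)
  qed
  interpret torus_pattern N 3 ?T "\<lambda>x. nat (x mod 3)" "\<lambda>i. Suc i mod 3"
  proof
    show "?T i j \<in> {1..4}" for i j
    proof -
      have "(i + j) mod 3 < 3" by simp
      then show ?thesis by simp
    qed
    show "?T i j \<noteq> ?T (Suc i mod 3) j \<and> ?T i j \<noteq> ?T i (Suc j mod 3) \<and>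
      ?T i j \<noteq> ?T (Suc i mod 3) (Suc j mod 3)" for i j
    proof -
      have "n mod 3 \<noteq> Suc n mod 3" "n mod 3 \<noteq> Suc (Suc n) mod 3" for n :: nat by presburger+
      moreover have "(Suc i mod 3 + j) mod 3 = Suc (i + j) mod 3" "(i + Suc j mod 3) mod 3 = Suc (i + j) mod 3"
        "(Suc i mod 3 + Suc j mod 3) mod 3 = Suc (Suc (i + j)) mod 3"
        using mod_add_left_eq[of "Suc i" 3 j] mod_add_right_eq[of i "Suc j" 3] mod_add_eq[of "Suc i" 3 "Suc j"]
        by simp_all
      ultimately show ?thesis by (simp only:) simp
    qed
  qed (simp_all only: succ, use assms(2) in \<open>simp_all add: nat_less_iff\<close>)
  have "?T i j \<noteq> 4" for i j
  proof -
    have "(i + j) mod 3 < 3" by simp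
    then show ?thesis by linarith
  qed
  then have "cell_degree i j = 0" for i j
    unfolding cell_degree_def face_sign_def by simp
  with pattern_coloring coloring_degree_pattern_coloring show thesis
    by (intro that) simp_all
qed

text \<open>A 2 by 2 block with all four colors, repeated with period 2, contributes 2 to the
  degree; there are nine blocks.\<close>

lemma degree_18_coloring:
  obtains f where "f \<in> colorings (torus_graph 6 6) 4" "coloring_degree 6 6 f = 18"
proof -
  let ?T = "\<lambda>i j. 1 + i + 2 * j :: nat"
  have succ: "nat ((x + 1) mod 6 mod 2) = 1 - nat (x mod 2)" for x :: int
  proof -
    have "(x + 1) mod 6 mod 2 = 1 - x mod 2" by (simp add: mod_mod_cancel) presburger
    then show ?thesis by (simp add: nat_diff_distrib)
  qed
  interpret torus_pattern 6 2 ?T "\<lambda>x. nat (x mod 2)" "\<lambda>i. 1 - i"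
    by unfold_locales (use succ in \<open>auto simp: less_2_cases_iff nat_less_iff\<close>)
  have "{0..<6} = {0, 1, 2, 3, 4, 5::int}" by auto
  then have "coloring_degree 6 6 pattern_coloring = 18"
    unfolding coloring_degree_pattern_coloring cell_degree_def face_sign_def by simp
  with pattern_coloring show thesis by (rule that)
qed

text \<open>Rows 0 to 8 and columns 0 to 8 are a coloring of \<open>T(9,9)\<close> of degree 6, found by computer search. Row 9
  repeats row 0 and column 9 repeats column 0, so that the strips formed by the last three rows and by
  the last three columns can be inserted any number of times.\<close>

definition pattern :: "nat \<Rightarrow> nat \<Rightarrow> nat" where
  "pattern i j =
    [[2, 1, 2, 3, 1, 2, 1, 3, 4, 2, 1, 4],
     [1, 3, 4, 1, 2, 4, 3, 4, 2, 1, 3, 2],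
     [3, 2, 1, 2, 4, 3, 1, 2, 1, 3, 2, 1],
     [4, 1, 3, 4, 3, 1, 2, 4, 3, 4, 1, 3],
     [2, 3, 4, 2, 1, 2, 4, 3, 1, 2, 3, 4],
     [3, 4, 2, 1, 3, 4, 3, 1, 2, 3, 1, 2],
     [1, 2, 1, 3, 4, 2, 1, 4, 3, 1, 2, 4],
     [2, 4, 3, 2, 1, 3, 4, 2, 1, 2, 4, 3],
     [4, 3, 1, 4, 3, 4, 2, 1, 3, 4, 3, 1],
     [2, 1, 2, 3, 1, 2, 1, 3, 4, 2, 1, 4],
     [1, 4, 3, 1, 2, 4, 3, 4, 2, 1, 3, 2],
     [4, 3, 1, 2, 4, 3, 2, 1, 3, 4, 2, 1]] ! j ! i"

text \<open>Indices 9, 10, 11 repeat from coordinate 9 on, in phase with \<open>x mod 3\<close>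
  because 3 divides 9. Negative \<open>x\<close> go to 0, which keeps every index below 12.\<close>

definition pattern_index :: "int \<Rightarrow> nat" where
  "pattern_index x = (if x < 9 then nat x else 9 + nat (x mod 3))"

text \<open>After 8 or 11 the actual next index is 0 or 9, depending on whether the torus closes up
  there. As 0 and 9 select equal rows and columns, 0 serves in both cases.\<close>

definition pattern_succ :: "nat \<Rightarrow> nat" where
  "pattern_succ i = (if i = 8 \<or> i = 11 then 0 else Suc i)"

lemma pattern_9: "i < 12 \<Longrightarrow> pattern 9 i = pattern 0 i \<and> pattern i 9 = pattern i 0"
proof -
  have "\<forall>i\<in>{..<12}. pattern 9 i = pattern 0 i \<and> pattern i 9 = pattern i 0" by code_simp
  then show "i < 12 \<Longrightarrow> ?thesis" by simp
qed

lemma pattern_proper: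
  assumes "i < 12" "j < 12"
  shows "pattern i j \<in> {1..4} \<and> pattern i j \<noteq> pattern (pattern_succ i) j \<and>
    pattern i j \<noteq> pattern i (pattern_succ j) \<and> pattern i j \<noteq> pattern (pattern_succ i) (pattern_succ j)"
proof -
  have "\<forall>i\<in>{..<12}. \<forall>j\<in>{..<12}. pattern i j \<in> {1..4} \<and> pattern i j \<noteq> pattern (pattern_succ i) j \<and>
    pattern i j \<noteq> pattern i (pattern_succ j) \<and> pattern i j \<noteq> pattern (pattern_succ i) (pattern_succ j)"
    by code_simp
  with assms show ?thesis by simp
qed

lemma pattern_index_succ:
  assumes "0 \<le> x" "x < 9 + 3 * int k"
  shows "pattern_index ((x + 1) mod (9 + 3 * int k)) = pattern_succ (pattern_index x) \<or>
    pattern_index ((x + 1) mod (9 + 3 * int k)) = 9 \<and> pattern_succ (pattern_index x) = 0"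
proof (cases "x + 1 = 9 + 3 * int k")
  case True
  \<comment> \<open>The side is divisible by 3, so the last coordinate has index 8 without strips
    and 11 with them.\<close>
  then have "x = 8 \<or> x \<ge> 9 \<and> x mod 3 = 2" by presburger
  with True show ?thesis by (auto simp: pattern_index_def pattern_succ_def)
next
  case False
  then have mod: "(x + 1) mod (9 + 3 * int k) = x + 1" using assms by simp
  have "x < 8 \<or> x = 8 \<or> x \<ge> 9 \<and> x mod 3 = 0 \<and> (x + 1) mod 3 = 1 \<or>
      x \<ge> 9 \<and> x mod 3 = 1 \<and> (x + 1) mod 3 = 2 \<or> x \<ge> 9 \<and> x mod 3 = 2 \<and> (x + 1) mod 3 = 0"
    by presburger
  then show ?thesis
    unfolding mod using assms by (auto simp: pattern_index_def pattern_succ_def nat_add_distrib)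
qed

lemma sum_pattern_index:
  fixes g :: "nat \<Rightarrow> int"
  shows "(\<Sum>x\<in>{0..<9 + 3 * int k}. g (pattern_index x)) = (\<Sum>i<9. g i) + int k * (\<Sum>i\<in>{9..<12}. g i)"
proof (induction k)
  case 0
  show ?case
    by (simp, rule sum.reindex_bij_witness[of _ int nat]) (auto simp: pattern_index_def)
next
  case (Suc k)
  let ?n = "9 + 3 * int k"
  have "{0..<9 + 3 * int (Suc k)} = {0..<?n} \<union> {?n, ?n + 1, ?n + 2}" by auto
  then have "(\<Sum>x\<in>{0..<9 + 3 * int (Suc k)}. g (pattern_index x)) = (\<Sum>x\<in>{0..<?n}. g (pattern_index x)) +
      (g (pattern_index ?n) + g (pattern_index (?n + 1)) + g (pattern_index (?n + 2)))"
    by (simp add: sum.union_disjoint)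
  moreover have "pattern_index ?n = 9" "pattern_index (?n + 1) = 10" "pattern_index (?n + 2) = 11"
  proof -
    have "?n mod 3 = 0" "(?n + 1) mod 3 = 1" "(?n + 2) mod 3 = 2" by presburger+
    then show "pattern_index ?n = 9" "pattern_index (?n + 1) = 10" "pattern_index (?n + 2) = 11"
      by (simp_all add: pattern_index_def)
  qed
  moreover have "{9..<12} = {9, 10, 11::nat}" by auto
  ultimately show ?case using Suc.IH by (simp add: algebra_simps)
qed

lemma degree_6_coloring:
  assumes "3 \<le> L"
  obtains f where "f \<in> colorings (torus_graph (3 * L) (3 * L)) 4" "coloring_degree (3 * L) (3 * L) f = 6"
proof -
  define k where "k = nat (L - 3)"
  then have L: "3 * L = 9 + 3 * int k" using assms by simp
  interpret torus_pattern "9 + 3 * int k" 12 pattern pattern_index pattern_succ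
  proof
    fix x :: int and j :: nat
    assume x: "0 \<le> x" "x < 9 + 3 * int k" and j: "j < 12"
    show "pattern (pattern_index ((x + 1) mod (9 + 3 * int k))) j = pattern (pattern_succ (pattern_index x)) j"
      "pattern j (pattern_index ((x + 1) mod (9 + 3 * int k))) = pattern j (pattern_succ (pattern_index x))"
      using pattern_index_succ[OF x] pattern_9[OF j] by auto
  next
    show "pattern_index x < 12" for x
    proof -
      have "nat x < 9" if "x < 9" using that by linarith
      moreover have "nat (x mod 3) < 3" by (simp add: nat_less_iff)
      ultimately show ?thesis by (auto simp: pattern_index_def)
    qed
    show "pattern_succ i < 12" if "i < 12" for i
      using that by (simp add: pattern_succ_def)
    show "pattern i j \<in> {1..4}" "pattern i j \<noteq> pattern (pattern_succ i) j \<and>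
      pattern i j \<noteq> pattern i (pattern_succ j) \<and> pattern i j \<noteq> pattern (pattern_succ i) (pattern_succ j)"
      if "i < 12" "j < 12" for i j
      using pattern_proper[OF that] by blast+
  qed simp
  let ?A = "{..<9}" and ?B = "{9..<12}"
  \<comment> \<open>Only the 9 by 9 base block contributes; every block touching a strip sums to 0,
    so the degree is the same for all \<open>k\<close>.\<close>
  have cells: "(\<Sum>i\<in>?A. \<Sum>j\<in>?A. cell_degree i j) = 6" "(\<Sum>i\<in>?A. \<Sum>j\<in>?B. cell_degree i j) = 0"
    "(\<Sum>i\<in>?B. \<Sum>j\<in>?A. cell_degree i j) = 0" "(\<Sum>i\<in>?B. \<Sum>j\<in>?B. cell_degree i j) = 0"
    unfolding cell_degree_def by code_simp+
  define g where "g i = (\<Sum>j\<in>?A. cell_degree i j) + int k * (\<Sum>j\<in>?B. cell_degree i j)" for i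
  have "coloring_degree (9 + 3 * int k) (9 + 3 * int k) pattern_coloring =
      (\<Sum>x\<in>{0..<9 + 3 * int k}. g (pattern_index x))"
    unfolding coloring_degree_pattern_coloring g_def by (simp only: sum_pattern_index)
  also have "\<dots> = (\<Sum>i\<in>?A. g i) + int k * (\<Sum>i\<in>?B. g i)"
    by (rule sum_pattern_index)
  also have "\<dots> = 6"
    unfolding g_def by (simp only: sum.distrib sum_distrib_left[symmetric] cells) simp
  finally have "coloring_degree (9 + 3 * int k) (9 + 3 * int k) pattern_coloring = 6" .
  with pattern_coloring show thesis
    unfolding L[symmetric] by (rule that)
qed

theorem theorem4p5:
  fixes L :: int
  assumes "L \<ge> 2"
  shows "(\<exists>f \<in> colorings (torus_graph (3 * L) (3 * L)) 4.
            [coloring_degree (3 * L) (3 * L) f = 6] (mod 12)) \<and>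
         kappa (torus_graph (3 * L) (3 * L)) 4 > 1 \<and>
         \<not> wsk_ergodic (torus_graph (3 * L) (3 * L)) 4"
proof -
  let ?G = "torus_graph (3 * L) (3 * L)"
  define P where "P f \<longleftrightarrow> [coloring_degree (3 * L) (3 * L) f = 6] (mod 12)" for f
  have N: "2 \<le> 3 * L" "3 dvd 3 * L" using assms by auto
  obtain f where f: "f \<in> colorings ?G 4" "P f"
  \<comment> \<open>The strip construction starts at side 9; side 6 uses degree 18, which is 6
    modulo 12.\<close>
  proof (cases "L = 2")
    case True
    obtain f where "f \<in> colorings (torus_graph 6 6) 4" "coloring_degree 6 6 f = 18"
      by (rule degree_18_coloring)
    with True show thesis by (intro that[of f]) (simp_all add: P_def cong_def)
  next
    case False
    then have "3 \<le> L" using assms by simp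
    then obtain f where "f \<in> colorings ?G 4" "coloring_degree (3 * L) (3 * L) f = 6"
      by (rule degree_6_coloring)
    then show thesis by (intro that[of f]) (simp_all add: P_def)
  qed
  obtain g where g: "g \<in> colorings ?G 4" and "coloring_degree (3 * L) (3 * L) g = 0"
    by (rule three_coloring[OF N(2,1)])
  then have not_P: "\<not> P g" by (simp add: P_def cong_def)
  have inv: "P (swap_on W a b h)" if "h \<in> colorings ?G 4" "a \<in> {1..4}" "b \<in> {1..4}" "a \<noteq> b"
    "kempe_closed ?G h a b W" "P h" for h a b W
    using coloring_degree_swap_on[OF N(1,1,2,2) that(1-5)] that(6) unfolding P_def by (rule cong_trans)
  have "kappa ?G 4 > 1"
  proof (rule kappa_gt_1[where P = P, OF _ f(1) g not_P f(2)])
    show "finite (verts ?G)" by (simp add: torus_graph_def finite_torus_verts)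
    fix h k assume hk: "(h, k) \<in> kempe_step ?G 4 \<union> color_perm ?G 4" and "P h"
    from hk show "P k"
    proof
      assume "(h, k) \<in> kempe_step ?G 4"
      then show "P k" by (rule kempe_step_invariant[where P = P, OF _ torus_edge_verts \<open>P h\<close> inv])
    next
      assume "(h, k) \<in> color_perm ?G 4"
      then show "P k" by (rule color_perm_invariant[where P = P, OF _ torus_edge_verts \<open>P h\<close> inv])
    qed
  qed
  moreover have "\<not> wsk_ergodic ?G 4"
    by (rule not_wsk_ergodic[where P = P, OF f(1) g _ torus_edge_verts not_P f(2) inv]) simp
  ultimately show ?thesis using f unfolding P_def by blast
qed

end
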